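(* Let $V^N$ and $U$ be the value functions on $\mathbb R^d$ defined in the context (quadratic running cost, terminal cost $m\mapsto d_1(m,\mathcal N_T)$). Then $U(0,\delta_0)=0$, and if $T$ is large enough, there is a constant $c>0$ such that for infinitely many values of $N\in\mathbb N$, $$V^N(0,0)\ge cN^{-1/d},$$ where the second argument $0$ is the origin of $(\mathbb R^d)^N$.
   Context: Fix $T>0$, $d\ge1$, and a filtered probability space satisfying the usual conditions, with atomless initial $\sigma$-field, carrying independent $d$-dimensional Brownian motions $W,(W^i)_{i\in\mathbb N}$. $\mathcal N_T$ is the Gaussian measure on $\mathbb R^d$ with mean $0$ and covariance $T I_{d\times d}$; $d_1$ is the 1-Wasserstein distance on probability measures on $\mathbb R^d$ with finite first moment; $m^N_{\boldsymbol x}=\frac1N\sum_{i=1}^N\delta_{x^i}$; $\mathcal L(X)$ is the law of $X$; $\mathcal P_2(\mathbb R^d)$ is the set of probability measures with finite second moment. For $(t_0,\boldsymbol x_0)\in[0,T]\times(\mathbb R^d)^N$, $$V^N(t_0,\boldsymbol x_0)=\inf_{\boldsymbol\alpha}\mathbb E\Big[\int_{t_0}^T\frac1{2N}\sum_{i=1}^N|\alpha^i_s|^2ds+d_1(m^N_{\boldsymbol X_T},\mathcal N_T)\Big],\quad dX^i_t=\alpha^i_tdt+dW^i_t,\ X^i_{t_0}=x^i_0,$$ the infimum being over square-integrable progressively measurable $\boldsymbol\alpha=(\alpha^1,\dots,\alpha^N)$ with values in $(\mathbb R^d)^N$. For $(t_0,m_0)\in[0,T]\times\mathcal P_2(\mathbb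 R^d)$, $$U(t_0,m_0)=\inf_{\alpha}\mathbb E\Big[\int_{t_0}^T\frac12|\alpha_t|^2dt+d_1(\mathcal L(X_T),\mathcal N_T)\Big],\quad dX_t=\alpha_tdt+dW_t,\ X_{t_0}=\xi\sim m_0,$$ the infimum being over square-integrable progressively measurable $\mathbb R^d$-valued $\alpha$. *)

theory Defs
  imports "HOL-Probability.Probability"
begin

definition wasserstein1 ::
    "'a::euclidean_space measure \<Rightarrow> 'a measure \<Rightarrow> ennreal" where
  "wasserstein1 \<mu> \<nu> =
     (INF \<pi> \<in> {\<pi> :: ('a \<times> 'a) measure. sets \<pi> = sets (borel \<Otimes>\<^sub>M borel) \<and>
                 distr \<pi> borel fst = \<mu> \<and> distr \<pi> borel snd = \<nu>}.
        \<integral>\<^sup>+ z. ennreal (dist (fst z) (snd z)) \<partial>\<pi>)"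

text \<open>The centred Gaussian with covariance \<open>v\<close> times the identity, for \<open>v > 0\<close>;
  \<open>normal_density\<close> takes the standard deviation as its second argument.\<close>

definition gaussian_measure :: "real \<Rightarrow> 'a::euclidean_space measure" where
  "gaussian_measure v =
     density lborel (\<lambda>x. ennreal (\<Prod>b\<in>Basis. normal_density 0 (sqrt v) (x \<bullet> b)))"

text \<open>The empirical measure of the points \<open>x 0, ..., x (N - 1)\<close>. Particles are
  numbered from 0 throughout.\<close>

definition empirical_measure :: "nat \<Rightarrow> (nat \<Rightarrow> 'a::euclidean_space) \<Rightarrow> 'a measure" where
  "empirical_measure N x =
     measure_of UNIV (sets borel) (\<lambda>A. (\<Sum>i<N. emeasure (return borel (x i)) A) / of_nat N)"

lemma emeasure_empirical_measure:
  assumes "A \<in> sets borel"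
  shows "emeasure (empirical_measure N x) A =
           (\<Sum>i<N. emeasure (return borel (x i)) A) / of_nat N"
proof (rule emeasure_measure_of[OF empirical_measure_def])
  let ?f = "\<lambda>A. (\<Sum>i<N. emeasure (return borel (x i)) A) / of_nat N"
  show "sets borel \<subseteq> Pow (UNIV :: 'a set)" by simp
  show "A \<in> sets (empirical_measure N x)"
    using assms sigma_algebra.sigma_sets_eq[OF sets.sigma_algebra_axioms, of "borel :: 'a measure"]
    by (simp add: empirical_measure_def)
  show "positive (sets (empirical_measure N x)) ?f"
    by (simp add: positive_def)
  show "countably_additive (sets (empirical_measure N x)) ?f"
  proof (rule countably_additiveI)
    fix S :: "nat \<Rightarrow> 'a set"
    assume S: "range S \<subseteq> sets (empirical_measure N x)" and d: "disjoint_family S"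
    have S': "range S \<subseteq> sets borel"
      using S sigma_algebra.sigma_sets_eq[OF sets.sigma_algebra_axioms, of "borel :: 'a measure"]
      by (simp add: empirical_measure_def)
    have "(\<Sum>k. ?f (S k)) = (\<Sum>k. \<Sum>i<N. emeasure (return borel (x i)) (S k)) / of_nat N"
      by simp
    also have "(\<Sum>k. \<Sum>i<N. emeasure (return borel (x i)) (S k))
                 = (\<Sum>i<N. \<Sum>k. emeasure (return borel (x i)) (S k))"
      by (rule suminf_sum) simp
    also have "\<dots> = (\<Sum>i<N. emeasure (return borel (x i)) (\<Union>k. S k))"
      using S' d by (intro sum.cong refl suminf_emeasure) auto
    finally show "(\<Sum>k. ?f (S k)) = ?f (\<Union>k. S k)" .
  qed
qed

text \<open>A Brownian motion on \<open>[0,T]\<close> relative to the filtration \<open>F\<close>.\<close>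

definition (in prob_space) brownian_motion ::
    "real \<Rightarrow> (real \<Rightarrow> 'a measure) \<Rightarrow> (real \<Rightarrow> 'a \<Rightarrow> 'b::euclidean_space) \<Rightarrow> bool" where
  "brownian_motion T F W \<longleftrightarrow>
     (\<forall>t\<in>{0..T}. W t \<in> borel_measurable (F t)) \<and>
     (AE \<omega> in M. W 0 \<omega> = 0) \<and>
     (AE \<omega> in M. continuous_on {0..T} (\<lambda>t. W t \<omega>)) \<and>
     (\<forall>s t. 0 \<le> s \<and> s < t \<and> t \<le> T \<longrightarrow>
        distr M borel (\<lambda>\<omega>. W t \<omega> - W s \<omega>) = gaussian_measure (t - s) \<and>
        indep_set (sets (F s)) (sets (vimage_algebra (space M) (\<lambda>\<omega>. W t \<omega> - W s \<omega>) borel)))"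

text \<open>The probability space, with filtration \<open>F\<close> indexed by \<open>[0,T]\<close> and Brownian
  motions \<open>W\<close> and \<open>B i\<close>; what \<open>F\<close>, \<open>W\<close> and \<open>B\<close> are outside \<open>[0,T]\<close> is irrelevant.\<close>

locale brownian_basis = prob_space M + complete_measure M
  for M :: "'w measure" +
  fixes T :: real
    and F :: "real \<Rightarrow> 'w measure"
    and W :: "real \<Rightarrow> 'w \<Rightarrow> 'a::euclidean_space"
    and B :: "nat \<Rightarrow> real \<Rightarrow> 'w \<Rightarrow> 'a"
  assumes T_pos: "0 < T"
    and subalgebra_F: "t \<in> {0..T} \<Longrightarrow> subalgebra M (F t)"
    and F_mono: "0 \<le> s \<Longrightarrow> s \<le> t \<Longrightarrow> t \<le> T \<Longrightarrow> sets (F s) \<subseteq> sets (F t)"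
    and null_sets_F: "null_sets M \<subseteq> sets (F 0)"
    and F_right_continuous: "0 \<le> t \<Longrightarrow> t < T \<Longrightarrow> sets (F t) = (\<Inter>s\<in>{t<..T}. sets (F s))"
    and F_0_atomless:
      "A \<in> sets (F 0) \<Longrightarrow> 0 < prob A \<Longrightarrow>
         \<exists>A'\<in>sets (F 0). A' \<subseteq> A \<and> 0 < prob A' \<and> prob A' < prob A"
    and W_brownian: "brownian_motion T F W"
    and B_brownian: "brownian_motion T F (B i)"
    and independent:
      "indep_vars (\<lambda>_. PiM {0..T} (\<lambda>_. borel))
         (\<lambda>i \<omega>. \<lambda>t\<in>{0..T}. case_nat W B i t \<omega>) (UNIV :: nat set)"

text \<open>Square-integrable progressively measurable controls on \<open>[t\<^sub>0,T]\<close>.\<close>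

definition admissible ::
    "'w measure \<Rightarrow> real \<Rightarrow> (real \<Rightarrow> 'w measure) \<Rightarrow> real \<Rightarrow> (real \<Rightarrow> 'w \<Rightarrow> 'a::euclidean_space) \<Rightarrow> bool" where
  "admissible M T F t\<^sub>0 \<alpha> \<longleftrightarrow>
     (\<forall>t\<in>{t\<^sub>0..T}. (\<lambda>(s, \<omega>). \<alpha> s \<omega>) \<in> borel_measurable (restrict_space borel {t\<^sub>0..t} \<Otimes>\<^sub>M F t)) \<and>
     (\<integral>\<^sup>+ \<omega>. (\<integral>\<^sup>+ s\<in>{t\<^sub>0..T}. ennreal ((norm (\<alpha> s \<omega>))\<^sup>2) \<partial>lborel) \<partial>M) < \<infinity>"

text \<open>The solution of \<open>dX = \<alpha> dt + dW\<close> with \<open>X = \<xi>\<close> at time \<open>t\<^sub>0\<close>. For admissible \<open>\<alpha>\<close>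
  almost every path of \<open>\<alpha>\<close> is integrable.\<close>

definition controlled_state ::
    "real \<Rightarrow> ('w \<Rightarrow> 'a::euclidean_space) \<Rightarrow> (real \<Rightarrow> 'w \<Rightarrow> 'a) \<Rightarrow> (real \<Rightarrow> 'w \<Rightarrow> 'a) \<Rightarrow> real \<Rightarrow> 'w \<Rightarrow> 'a" where
  "controlled_state t\<^sub>0 \<xi> \<alpha> W t \<omega> =
     \<xi> \<omega> + (LINT s:{t\<^sub>0..t}|lborel. \<alpha> s \<omega>) + (W t \<omega> - W t\<^sub>0 \<omega>)"

text \<open>All costs are nonnegative, so expectations and infima are taken in \<open>ennreal\<close>.\<close>

definition value_N ::
    "'w measure \<Rightarrow> real \<Rightarrow> (real \<Rightarrow> 'w measure) \<Rightarrow> (nat \<Rightarrow> real \<Rightarrow> 'w \<Rightarrow> 'a::euclidean_space) \<Rightarrow>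
     nat \<Rightarrow> real \<Rightarrow> (nat \<Rightarrow> 'a) \<Rightarrow> ennreal" where
  "value_N M T F B N t\<^sub>0 x\<^sub>0 =
     (INF \<alpha> \<in> {\<alpha>. \<forall>i<N. admissible M T F t\<^sub>0 (\<alpha> i)}.
        \<integral>\<^sup>+ \<omega>. (\<integral>\<^sup>+ s\<in>{t\<^sub>0..T}. ennreal (1 / (2 * real N) * (\<Sum>i<N. (norm (\<alpha> i s \<omega>))\<^sup>2)) \<partial>lborel)
             + wasserstein1
                 (empirical_measure N (\<lambda>i. controlled_state t\<^sub>0 (\<lambda>_. x\<^sub>0 i) (\<alpha> i) (B i) T \<omega>))
                 (gaussian_measure T) \<partial>M)"

text \<open>The initial condition ranges over all \<open>F t\<^sub>0\<close>-measurable \<open>\<xi>\<close> with law \<open>m\<^sub>0\<close>.\<close>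

definition value_MF ::
    "'w measure \<Rightarrow> real \<Rightarrow> (real \<Rightarrow> 'w measure) \<Rightarrow> (real \<Rightarrow> 'w \<Rightarrow> 'a::euclidean_space) \<Rightarrow>
     real \<Rightarrow> 'a measure \<Rightarrow> ennreal" where
  "value_MF M T F W t\<^sub>0 m\<^sub>0 =
     (INF (\<xi>, \<alpha>) \<in> {(\<xi>, \<alpha>). \<xi> \<in> borel_measurable (F t\<^sub>0) \<and> distr M borel \<xi> = m\<^sub>0 \<and>
                        admissible M T F t\<^sub>0 \<alpha>}.
        \<integral>\<^sup>+ \<omega>. (\<integral>\<^sup>+ s\<in>{t\<^sub>0..T}. ennreal (1 / 2 * (norm (\<alpha> s \<omega>))\<^sup>2) \<partial>lborel)
             + wasserstein1 (distr M borel (controlled_state t\<^sub>0 \<xi> \<alpha> W T)) (gaussian_measure T) \<partial>M)"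

end

(* The lower bound is the quantization bound and ignores the controls: in the N-particle
   problem the terminal measure is supported on N points. Balls of radius of order
   N powr (-1/d) around any N points carry at most half of the mass of a measure with bounded
   density, so every coupling moves mass at least 1/2 over such a distance. For the mean-field
   problem the zero control is optimal, since W T has law N_T. *)

theory Submission
  imports Defs
begin

text \<open>Each one-dimensional factor is largest at its mean, where the exponential equals
  1.\<close>

lemma prod_normal_density_le:
  assumes "0 < v"
  shows "(\<Prod>b\<in>Basis. normal_density 0 (sqrt v) ((x :: 'a::euclidean_space) \<bullet> b))
           \<le> (1 / sqrt (2 * pi * v)) ^ DIM('a)"
proof -
  have "normal_density 0 (sqrt v) y \<le> 1 / sqrt (2 * pi * v)" for y
    using assms by (simp add: normal_density_def divide_right_mono)
  then have "(\<Prod>b\<in>Basis. normal_density 0 (sqrt v) (x \<bullet> b))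
               \<le> (\<Prod>b\<in>(Basis :: 'a set). 1 / sqrt (2 * pi * v))"
    by (intro prod_mono) auto
  then show ?thesis by simp
qed

lemma sets_gaussian_measure [simp, measurable_cong]:
  "sets (gaussian_measure v :: 'a::euclidean_space measure) = sets borel"
  by (simp add: gaussian_measure_def)

text \<open>Boundedness of the density enters the quantization bound in this form: small Lebesgue
  volume forces small Gaussian mass.\<close>

lemma emeasure_gaussian_measure_le:
  assumes "0 < v" and A: "A \<in> sets borel"
  shows "emeasure (gaussian_measure v) A
           \<le> ennreal ((1 / sqrt (2 * pi * v)) ^ DIM('a)) * emeasure lborel (A :: 'a::euclidean_space set)"
proof -
  let ?K = "(1 / sqrt (2 * pi * v)) ^ DIM('a)"
  have "emeasure (gaussian_measure v) A
          = (\<integral>\<^sup>+x. ennreal (\<Prod>b\<in>Basis. normal_density 0 (sqrt v) (x \<bullet> b)) * indicator A x \<partial>lborel)"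
    using A unfolding gaussian_measure_def by (intro emeasure_density) auto
  also have "\<dots> \<le> (\<integral>\<^sup>+x. ennreal ?K * indicator A x \<partial>lborel)"
    using assms(1) by (intro nn_integral_mono mult_right_mono ennreal_leI prod_normal_density_le) auto
  also have "\<dots> = ennreal ?K * emeasure lborel A"
    using A by (simp add: nn_integral_cmult_indicator)
  finally show ?thesis .
qed

lemma sets_empirical_measure [simp, measurable_cong]:
  "sets (empirical_measure N x) = sets borel"
  using sigma_algebra.sigma_sets_eq[OF sets.sigma_algebra_axioms, of "borel :: 'a measure"]
  by (simp add: empirical_measure_def)

lemma emeasure_empirical_measure_eq_1:
  assumes "0 < N" "A \<in> sets borel" "x ` {..<N} \<subseteq> A"
  shows "emeasure (empirical_measure N x) A = 1"
proof -
  have "(\<Sum>i<N. emeasure (return borel (x i)) A) = (\<Sum>i<N. 1)"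
    using assms by (intro sum.cong) auto
  then show ?thesis
    using assms by (simp add: emeasure_empirical_measure ennreal_divide_self of_nat_less_top)
qed

lemma emeasure_empirical_measure_eq_0:
  assumes "A \<in> sets borel" "x ` {..<N} \<inter> A = {}"
  shows "emeasure (empirical_measure N x) A = 0"
proof -
  have "(\<Sum>i<N. emeasure (return borel (x i)) A) = (\<Sum>i<N. 0)"
    using assms by (intro sum.cong) (auto simp: indicator_def)
  then show ?thesis
    using assms by (simp add: emeasure_empirical_measure)
qed

lemma wasserstein1_self:
  assumes "sets \<mu> = sets borel"
  shows "wasserstein1 \<mu> \<mu> = 0"
proof -
  note [measurable_cong] = assms
  \<comment> \<open>The diagonal coupling leaves all mass in place.\<close>
  let ?\<pi> = "distr \<mu> (borel \<Otimes>\<^sub>M borel) (\<lambda>x. (x, x))"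
  have "distr ?\<pi> borel fst = \<mu>" "distr ?\<pi> borel snd = \<mu>"
    using assms by (simp_all add: distr_distr comp_def distr_id2)
  then have "wasserstein1 \<mu> \<mu> \<le> (\<integral>\<^sup>+z. ennreal (dist (fst z) (snd z)) \<partial>?\<pi>)"
    unfolding wasserstein1_def by (intro INF_lower) auto
  also have "\<dots> = 0"
    by (subst nn_integral_distr) auto
  finally show ?thesis by simp
qed

text \<open>A Markov-type estimate: under any coupling the first coordinate is almost surely one of
  the points, while the second lies outside all the balls with mass at least 1/2. On that event the
  distance exceeds \<open>r\<close>, which costs at least \<open>r / 2\<close>.\<close>

lemma wasserstein1_empirical_measure_ge:
  assumes "0 < N" "0 \<le> r" and \<nu>: "sets \<nu> = sets borel"
    and half: "emeasure \<nu> (\<Union>i<N. cball (x i) r) \<le> ennreal (1 / 2)"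
  shows "ennreal (r / 2) \<le> wasserstein1 (empirical_measure N x) \<nu>"
  unfolding wasserstein1_def
proof (rule INF_greatest, elim CollectE conjE)
  fix \<pi> :: "('a \<times> 'a) measure"
  assume sets: "sets \<pi> = sets (borel \<Otimes>\<^sub>M borel)"
    and fst: "distr \<pi> borel fst = empirical_measure N x"
    and snd: "distr \<pi> borel snd = \<nu>"
  note [measurable_cong] = sets
  let ?U = "\<Union>i<N. cball (x i) r"
  have U [measurable]: "?U \<in> sets borel" by measurable
  have [measurable]: "x ` {..<N} \<in> sets borel"
    by (intro borel_closed finite_imp_closed) auto
  \<comment> \<open>The total mass 1 of \<nu> is transferred through \<pi> from the other
    marginal.\<close>
  have "emeasure \<nu> UNIV = emeasure \<pi> (space \<pi>)"
    by (subst snd[symmetric], subst emeasure_distr) auto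
  also have "\<dots> = emeasure (empirical_measure N x) UNIV"
    by (subst fst[symmetric], subst emeasure_distr) auto
  also have "\<dots> = 1"
    using assms(1) by (intro emeasure_empirical_measure_eq_1) auto
  finally have "emeasure \<nu> (?U \<union> - ?U) = 1" by (simp only: Compl_partition)
  then have "1 \<le> emeasure \<nu> ?U + emeasure \<nu> (- ?U)"
    by (metis U \<nu> borel_comp emeasure_subadditive)
  also have "\<dots> \<le> ennreal (1 / 2) + emeasure \<nu> (- ?U)"
    by (intro add_right_mono half)
  finally have far_sum: "1 \<le> ennreal (1 / 2) + emeasure \<nu> (- ?U)" .
  \<comment> \<open>The term 1/2 is cancelled in the reals; an infinite value satisfies the bound
    trivially.\<close>
  have far: "ennreal (1 / 2) \<le> emeasure \<nu> (- ?U)"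
  proof (cases "emeasure \<nu> (- ?U)" rule: ennreal_cases)
    case (real p)
    with far_sum have "ennreal 1 \<le> ennreal (1 / 2 + p)"
      by (simp only: ennreal_1 ennreal_plus)
    with real show ?thesis by (simp only: ennreal_le_iff)
  qed simp
  have "emeasure \<pi> (fst -` (- x ` {..<N}) \<inter> space \<pi>) = emeasure (empirical_measure N x) (- x ` {..<N})"
    by (subst fst[symmetric], subst emeasure_distr) auto
  also have "\<dots> = 0"
    by (intro emeasure_empirical_measure_eq_0) auto
  finally have "AE z in \<pi>. fst z \<in> x ` {..<N}"
    by (intro AE_I'[where N = "fst -` (- x ` {..<N}) \<inter> space \<pi>"]) (auto simp: null_sets_def)
  \<comment> \<open>If \<open>fst z\<close> is some \<open>x i\<close> and \<open>snd z\<close>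
    avoids every ball, then in particular it is farther than \<open>r\<close> from
    \<open>x i\<close>; inside the balls the left side is 0.\<close>
  then have le: "AE z in \<pi>. ennreal r * indicator (- ?U) (snd z) \<le> ennreal (dist (fst z) (snd z))"
    by eventually_elim (auto simp: indicator_def not_le intro!: ennreal_leI less_imp_le)
  have "ennreal (r / 2) = ennreal r * ennreal (1 / 2)"
    using assms(2) by (subst ennreal_mult[symmetric]) auto
  also have "\<dots> \<le> ennreal r * emeasure \<nu> (- ?U)"
    by (intro mult_left_mono far) simp
  also have "\<dots> = (\<integral>\<^sup>+y. ennreal r * indicator (- ?U) y \<partial>\<nu>)"
    by (rule nn_integral_cmult_indicator[symmetric]) (simp only: \<nu> borel_comp U)
  also have "\<dots> = (\<integral>\<^sup>+z. ennreal r * indicator (- ?U) (snd z) \<partial>\<pi>)"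
    unfolding snd[symmetric] by (rule nn_integral_distr) measurable
  also have "\<dots> \<le> (\<integral>\<^sup>+z. ennreal (dist (fst z) (snd z)) \<partial>\<pi>)"
    by (intro nn_integral_mono_AE le)
  finally show "ennreal (r / 2) \<le> (\<integral>\<^sup>+z. ennreal (dist (fst z) (snd z)) \<partial>\<pi>)" .
qed

text \<open>The radius is tuned so that the union bound over the \<open>N\<close> balls gives
  Gaussian mass at most 1/2. The constant depends on \<open>v\<close> and the dimension alone,
  uniformly in \<open>N\<close> and in the points.\<close>

lemma wasserstein1_empirical_gaussian_ge:
  assumes "0 < v"
  shows "\<exists>c>0. \<forall>N>0. \<forall>x :: nat \<Rightarrow> 'a::euclidean_space.
           ennreal (c * real N powr (- 1 / real DIM('a)))
             \<le> wasserstein1 (empirical_measure N x) (gaussian_measure v)"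
proof -
  let ?d = "real DIM('a)"
  define K where "K = (1 / sqrt (2 * pi * v)) ^ DIM('a)"
  define V where "V = unit_ball_vol ?d"
  \<comment> \<open>Solves \<open>N * K * V * r ^ d = 1 / 2\<close> for
    \<open>r = \<rho> * N powr (- 1 / d)\<close>, with \<open>d\<close> the dimension; the factors
    \<open>N\<close> cancel.\<close>
  define \<rho> where "\<rho> = (1 / (2 * K * V)) powr (1 / ?d)"
  have pos: "0 < K" "0 < V"
    using assms by (auto simp: K_def V_def)
  then have "0 < \<rho>" by (simp add: \<rho>_def)
  have \<rho>_power: "\<rho> ^ DIM('a) = 1 / (2 * K * V)"
    using pos by (simp add: \<rho>_def powr_powr flip: powr_realpow)
  have "ennreal (\<rho> / 2 * real N powr (- 1 / ?d)) \<le> wasserstein1 (empirical_measure N x) (gaussian_measure v)"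
    if "0 < N" for N and x :: "nat \<Rightarrow> 'a"
  proof -
    define r where "r = \<rho> * real N powr (- 1 / ?d)"
    have "0 < r" using that \<open>0 < \<rho>\<close> by (simp add: r_def)
    have "(real N powr (- 1 / ?d)) ^ DIM('a) = 1 / real N"
      using that by (simp add: powr_powr powr_neg_one flip: powr_realpow)
    then have r_power: "r ^ DIM('a) = 1 / (2 * K * V) / real N"
      by (simp add: r_def power_mult_distrib \<rho>_power)
    have "emeasure (gaussian_measure v) (\<Union>i<N. cball (x i) r)
            \<le> (\<Sum>i<N. emeasure (gaussian_measure v) (cball (x i) r))"
      by (intro emeasure_subadditive_finite) auto
    also have "\<dots> \<le> (\<Sum>i<N. ennreal K * emeasure lborel (cball (x i) r))"
      unfolding K_def using assms by (intro sum_mono emeasure_gaussian_measure_le) auto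
    \<comment> \<open>A ball of radius \<open>r\<close> has volume \<open>V * r ^ d\<close>, so each
      summand is \<open>K * V * r ^ d\<close>.\<close>
    also have "\<dots> = (\<Sum>i<N. ennreal (1 / (2 * real N)))"
      using \<open>0 < r\<close> pos by (simp add: emeasure_cball r_power flip: V_def ennreal_mult)
    also have "\<dots> = ennreal (\<Sum>i<N. 1 / (2 * real N))"
      by (intro sum_ennreal) auto
    also have "\<dots> = ennreal (1 / 2)"
      using that by simp
    finally show ?thesis
      using wasserstein1_empirical_measure_ge[of N r "gaussian_measure v" x] that \<open>0 < r\<close>
      by (simp add: r_def)
  qed
  then show ?thesis
    using \<open>0 < \<rho>\<close> by (intro exI[of _ "\<rho> / 2"]) auto
qed

text \<open>The running cost is nonnegative and the terminal cost is at least \<open>C\<close> for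
  every outcome, wherever the control has steered the particles. As \<open>M\<close> has mass 1,
  integrating keeps \<open>C\<close>.\<close>

lemma (in prob_space) value_N_ge:
  assumes "\<And>x :: nat \<Rightarrow> 'b::euclidean_space.
             C \<le> wasserstein1 (empirical_measure N x) (gaussian_measure T)"
  shows "C \<le> value_N M T F (B :: nat \<Rightarrow> real \<Rightarrow> 'a \<Rightarrow> 'b) N t\<^sub>0 x\<^sub>0"
  unfolding value_N_def
proof (rule INF_greatest)
  fix \<alpha> :: "nat \<Rightarrow> real \<Rightarrow> 'a \<Rightarrow> 'b"
  have "C = (\<integral>\<^sup>+\<omega>. C \<partial>M)"
    by (simp add: emeasure_space_1)
  also have "\<dots> \<le> (\<integral>\<^sup>+ \<omega>. (\<integral>\<^sup>+ s\<in>{t\<^sub>0..T}. ennreal (1 / (2 * real N) * (\<Sum>i<N. (norm (\<alpha> i s \<omega>))\<^sup>2)) \<partial>lborel)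
             + wasserstein1
                 (empirical_measure N (\<lambda>i. controlled_state t\<^sub>0 (\<lambda>_. x\<^sub>0 i) (\<alpha> i) (B i) T \<omega>))
                 (gaussian_measure T) \<partial>M)"
    by (intro nn_integral_mono add_increasing assms) simp
  finally show "C \<le> \<dots>" .
qed

lemma (in brownian_basis) value_MF_0_return_0:
  "value_MF M T F W 0 (return borel 0) = 0"
proof -
  have "controlled_state 0 (\<lambda>_. 0) (\<lambda>_ _. 0) W T = (\<lambda>\<omega>. W T \<omega> - W 0 \<omega>)"
    by (auto simp: controlled_state_def)
  \<comment> \<open>The increment over the whole interval, \<open>s = 0\<close> and
    \<open>t = T\<close>, has variance \<open>T\<close>, exactly that of the target.\<close>
  moreover have "distr M borel (\<lambda>\<omega>. W T \<omega> - W 0 \<omega>) = gaussian_measure T"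
    using W_brownian T_pos unfolding brownian_motion_def by force
  ultimately have law: "distr M borel (controlled_state 0 (\<lambda>_. 0) (\<lambda>_ _. 0) W T) = gaussian_measure T"
    by simp
  have "admissible M T F 0 (\<lambda>_ _. 0 :: 'a)"
    by (simp add: admissible_def case_prod_beta)
  moreover have "distr M borel (\<lambda>_. 0 :: 'a) = return borel 0"
    by (intro distr_const) auto
  ultimately have "value_MF M T F W 0 (return borel 0)
      \<le> (\<integral>\<^sup>+ \<omega>. (\<integral>\<^sup>+ s\<in>{0..T}. ennreal (1 / 2 * (norm (0 :: 'a))\<^sup>2) \<partial>lborel)
             + wasserstein1 (distr M borel (controlled_state 0 (\<lambda>_. 0) (\<lambda>_ _. 0) W T)) (gaussian_measure T) \<partial>M)"
    \<comment> \<open>Competitor: the deterministic start 0, of law \<open>return borel 0\<close>,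
      with zero control; both of its costs vanish.\<close>
    unfolding value_MF_def by (intro INF_lower2[of "(\<lambda>_. 0, \<lambda>_ _. 0)"]) auto
  then show ?thesis
    by (simp add: law wasserstein1_self)
qed

theorem proposition2p9:
  shows "(\<forall>T > 0. \<forall>(M :: 'w measure) F (W :: real \<Rightarrow> 'w \<Rightarrow> real ^ 'd) B.
            brownian_basis M T F W B \<longrightarrow> value_MF M T F W 0 (return borel 0) = 0) \<and>
         (\<exists>T\<^sub>0 > 0. \<forall>T \<ge> T\<^sub>0. \<forall>(M :: 'w measure) F (W :: real \<Rightarrow> 'w \<Rightarrow> real ^ 'd) B.
            brownian_basis M T F W B \<longrightarrow>
              (\<exists>c > 0. infinite {N. value_N M T F B N 0 (\<lambda>_. 0) \<ge>
                                     ennreal (c * real N powr (- 1 / real CARD('d)))}))"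
proof -
  have "\<exists>c>0. infinite {N. value_N M T F B N 0 (\<lambda>_. 0) \<ge> ennreal (c * real N powr (- 1 / real CARD('d)))}"
    if "brownian_basis M T F W B"
    for T and M :: "'w measure" and F and W :: "real \<Rightarrow> 'w \<Rightarrow> real ^ 'd" and B
  proof -
    interpret brownian_basis M T F W B by fact
    obtain c where "0 < c" and c: "\<And>N x. 0 < N \<Longrightarrow>
        ennreal (c * real N powr (- 1 / real CARD('d)))
          \<le> wasserstein1 (empirical_measure N (x :: nat \<Rightarrow> real ^ 'd)) (gaussian_measure T)"
      using wasserstein1_empirical_gaussian_ge[OF T_pos, where 'a = "real ^ 'd"] by auto
    \<comment> \<open>The bound holds for every positive \<open>N\<close>, with \<open>c\<close>
      fixed before \<open>N\<close>; \<open>N = 0\<close> is left out because an empirical measure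
      of mass 1 needs a point.\<close>
    have "{0<..} \<subseteq> {N. value_N M T F B N 0 (\<lambda>_. 0) \<ge> ennreal (c * real N powr (- 1 / real CARD('d)))}"
      using c by (auto intro!: value_N_ge)
    then show ?thesis
      using \<open>0 < c\<close> infinite_Ioi infinite_super by blast
  qed
  then show ?thesis
    \<comment> \<open>The threshold 1 is an arbitrary positive choice: the estimate above covers
      every horizon of a \<open>brownian_basis\<close>.\<close>
    by (auto intro: brownian_basis.value_MF_0_return_0 exI[of _ 1])
qed

end
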